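(* Let $K\ge2$, $0<v_1<\dots<v_K$, let $x^*$ be the aggregated market and $\beta\in[0,1]$. The minimum producer utility over all segmentations (and optimal pricing rules) under the privacy mechanism with parameter $\beta$ is at most that in the non-private case $\beta=0$: $$\min\{u_p:(u_c,u_p)\in\mathcal S_\beta\}\ \le\ \min\{u_p:(u_c,u_p)\in\mathcal S_0\}.$$
   Context: $\mathcal V=\{v_1,\dots,v_K\}$; a market is a probability distribution $x$ on $\mathcal V$; $\mathcal X$ is the simplex of all markets, $\mathrm{Unif}(\mathcal X)$ the uniform distribution on it. The aggregated market is a fixed $x^*\in\mathcal X$. A segmentation is a finitely supported probability distribution $\sigma$ on $\mathcal X$ with $\sum_x\sigma(x)x=x^*$; $\Sigma$ is the set of segmentations. For a price $p\ge0$ and market $x$: $\mathcal U_p(p,x)=p\sum_k x(v_k)\mathbf 1(p\le v_k)$ and $\mathcal U_c(p,x)=\sum_k x(v_k)(v_k-p)\mathbf 1(p\le v_k)$. Privacy mechanism: $\mathcal M_\beta(x)$ equals $x$ with probability $1-\beta$ and, with probability $\beta$, is an independent draw from $\mathrm{Unif}(\mathcal X)$. The producer has prior $\mathrm{Unif}(\mathcal X)$; after observing $\hat x$ the posterior is $\pi_\beta(\cdot|\hat x)=(1-\beta)\delta_{\hat x}+\beta\,\mathrm{Unif}(\mathcal X)$. Put $\mathcal U_p(p|\hat x)=\mathbb E_{x\sim\pi_\beta(\cdot|\hat x)}[\mathcal U_p(p,x)]$. A price $p$ is optimal given $\hat x$ if $\mathcal U_p(p|\hat x)\ge\mathcal U_p(p'|\hat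 x)$ for all $p'\ge0$ (optimal prices lie in $\mathcal V$). An optimal pricing rule is a (measurable) map $\phi:\mathcal X\to\Delta(\mathcal V)$ such that for each $\hat x$ the support of $\phi(\hat x)$ consists only of prices optimal given $\hat x$. For $\bullet\in\{p,c\}$ let $U_\bullet^\phi(x)=\mathbb E_{\hat x\sim\mathcal M_\beta(x)}\mathbb E_{q\sim\phi(\hat x)}[\mathcal U_\bullet(q,x)]$. Then $\mathcal S_\beta$ is the set of pairs $\big(\sum_x\sigma(x)U_c^\phi(x),\ \sum_x\sigma(x)U_p^\phi(x)\big)$ over all $\sigma\in\Sigma$ and all optimal pricing rules $\phi$ (for parameter $\beta$). *)

theory Defs
  imports "HOL-Probability.Probability"
begin

text \<open>
  Throughout, the valuations are \<open>v 1 < \<dots> < v K\<close>; a market is given by its weights, \<open>x k\<close> being the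
  probability of \<open>v k\<close>, and \<open>x\<close> is \<open>undefined\<close> outside \<open>{1..K}\<close>.
\<close>

type_synonym market = "nat \<Rightarrow> real"

definition markets :: "nat \<Rightarrow> market set" where
  "markets K = {x \<in> {1..K} \<rightarrow>\<^sub>E UNIV. (\<forall>k\<in>{1..K}. 0 \<le> x k) \<and> (\<Sum>k=1..K. x k) = 1}"

definition market_space :: "nat \<Rightarrow> market measure" where
  "market_space K = restrict_space (\<Pi>\<^sub>M k\<in>{1..K}. borel) (markets K)"

text \<open>
  The uniform distribution on the \<open>K - 1\<close> dimensional simplex is the image of normalised Lebesgue
  measure under the affine parametrisation by the first \<open>K - 1\<close> weights.
\<close>

definition param_domain :: "nat \<Rightarrow> (nat \<Rightarrow> real) set" where
  "param_domain K = {y \<in> {1..<K} \<rightarrow>\<^sub>E UNIV. (\<forall>k\<in>{1..<K}. 0 \<le> y k) \<and> (\<Sum>k=1..<K. y k) \<le> 1}"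

definition param :: "nat \<Rightarrow> (nat \<Rightarrow> real) \<Rightarrow> market" where
  "param K y = (\<lambda>k\<in>{1..K}. if k < K then y k else 1 - (\<Sum>j=1..<K. y j))"

definition uniform_market :: "nat \<Rightarrow> market measure" where
  "uniform_market K =
     distr
       (uniform_measure (restrict_space (\<Pi>\<^sub>M k\<in>{1..<K}. lborel) (param_domain K)) (param_domain K))
       (market_space K) (param K)"

definition segmentation :: "nat \<Rightarrow> market \<Rightarrow> market pmf \<Rightarrow> bool" where
  "segmentation K xstar \<sigma> \<longleftrightarrow>
     finite (set_pmf \<sigma>) \<and> set_pmf \<sigma> \<subseteq> markets K \<and>
     (\<forall>k\<in>{1..K}. (\<Sum>x\<in>set_pmf \<sigma>. pmf \<sigma> x * x k) = xstar k)"

definition producer_utility :: "nat \<Rightarrow> (nat \<Rightarrow> real) \<Rightarrow> real \<Rightarrow> market \<Rightarrow> real" where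
  "producer_utility K v p x = p * (\<Sum>k=1..K. x k * of_bool (p \<le> v k))"

definition consumer_utility :: "nat \<Rightarrow> (nat \<Rightarrow> real) \<Rightarrow> real \<Rightarrow> market \<Rightarrow> real" where
  "consumer_utility K v p x = (\<Sum>k=1..K. x k * (v k - p) * of_bool (p \<le> v k))"

definition mechanism :: "nat \<Rightarrow> real \<Rightarrow> market \<Rightarrow> market measure" where
  "mechanism K \<beta> x =
     measure_pmf (bernoulli_pmf \<beta>) \<bind>
       (\<lambda>b. if b then uniform_market K else return (market_space K) x)"

text \<open>
  With the uniform prior, the posterior given \<open>xhat\<close> puts weight \<open>1 - \<beta>\<close> on \<open>xhat\<close> and weight \<open>\<beta>\<close> on
  the uniform distribution, so it has the same form as the mechanism.
\<close>

definition posterior :: "nat \<Rightarrow> real \<Rightarrow> market \<Rightarrow> market measure" where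
  "posterior K \<beta> xhat =
     measure_pmf (bernoulli_pmf \<beta>) \<bind>
       (\<lambda>b. if b then uniform_market K else return (market_space K) xhat)"

definition posterior_utility :: "nat \<Rightarrow> (nat \<Rightarrow> real) \<Rightarrow> real \<Rightarrow> real \<Rightarrow> market \<Rightarrow> real" where
  "posterior_utility K v \<beta> p xhat = (\<integral>x. producer_utility K v p x \<partial>posterior K \<beta> xhat)"

definition optimal_price :: "nat \<Rightarrow> (nat \<Rightarrow> real) \<Rightarrow> real \<Rightarrow> market \<Rightarrow> real \<Rightarrow> bool" where
  "optimal_price K v \<beta> xhat p \<longleftrightarrow>
     0 \<le> p \<and> (\<forall>p'\<ge>0. posterior_utility K v \<beta> p' xhat \<le> posterior_utility K v \<beta> p xhat)"

definition optimal_rule :: "nat \<Rightarrow> (nat \<Rightarrow> real) \<Rightarrow> real \<Rightarrow> (market \<Rightarrow> real pmf) \<Rightarrow> bool" where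
  "optimal_rule K v \<beta> \<phi> \<longleftrightarrow>
     (\<forall>k\<in>{1..K}. (\<lambda>xhat. pmf (\<phi> xhat) (v k)) \<in> borel_measurable (market_space K)) \<and>
     (\<forall>xhat\<in>markets K. set_pmf (\<phi> xhat) \<subseteq> {p \<in> v ` {1..K}. optimal_price K v \<beta> xhat p})"

definition rule_utility ::
    "nat \<Rightarrow> real \<Rightarrow> (market \<Rightarrow> real pmf) \<Rightarrow> (real \<Rightarrow> market \<Rightarrow> real) \<Rightarrow> market \<Rightarrow> real" where
  "rule_utility K \<beta> \<phi> U x =
     (\<integral>xhat. measure_pmf.expectation (\<phi> xhat) (\<lambda>q. U q x) \<partial>mechanism K \<beta> x)"

definition utility_set :: "nat \<Rightarrow> (nat \<Rightarrow> real) \<Rightarrow> market \<Rightarrow> real \<Rightarrow> (real \<times> real) set" where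
  "utility_set K v xstar \<beta> =
     {(\<Sum>x\<in>set_pmf \<sigma>. pmf \<sigma> x * rule_utility K \<beta> \<phi> (consumer_utility K v) x,
       \<Sum>x\<in>set_pmf \<sigma>. pmf \<sigma> x * rule_utility K \<beta> \<phi> (producer_utility K v) x) | \<sigma> \<phi>.
      segmentation K xstar \<sigma> \<and> optimal_rule K v \<beta> \<phi>}"

definition is_minimum :: "real set \<Rightarrow> real \<Rightarrow> bool" where
  "is_minimum A m \<longleftrightarrow> m \<in> A \<and> (\<forall>a\<in>A. m \<le> a)"


lemma space_market_space [simp]: "space (market_space K) = markets K"
  by (auto simp: market_space_def space_restrict_space space_PiM markets_def)

lemma param_in_markets:
  assumes "K \<ge> 1" "y \<in> param_domain K"
  shows "param K y \<in> markets K"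
proof -
  have "{1..K} = insert K {1..<K}" using assms(1) by auto
  then have "(\<Sum>k=1..K. param K y k) = param K y K + (\<Sum>k=1..<K. param K y k)" by simp
  also have "(\<Sum>k=1..<K. param K y k) = (\<Sum>k=1..<K. y k)"
    by (rule sum.cong) (auto simp: param_def)
  finally have "(\<Sum>k=1..K. param K y k) = 1" using assms(1) by (simp add: param_def)
  moreover have "0 \<le> param K y k" if "k \<in> {1..K}" for k
    using that assms by (auto simp: param_def param_domain_def)
  ultimately show ?thesis by (auto simp: markets_def param_def)
qed

lemma param_measurable:
  assumes "K \<ge> 1"
  shows "param K \<in> restrict_space (\<Pi>\<^sub>M k\<in>{1..<K}. lborel) (param_domain K) \<rightarrow>\<^sub>M market_space K"
  unfolding market_space_def
proof (rule measurable_restrict_space2)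
  let ?L = "\<Pi>\<^sub>M k\<in>{1..<K}. (lborel :: real measure)"
  show "param K \<in> space (restrict_space ?L (param_domain K)) \<rightarrow> markets K"
    using param_in_markets[OF assms] by (auto simp: space_restrict_space)
  have c: "(\<lambda>y. y j) \<in> borel_measurable ?L" if "j \<in> {1..<K}" for j
    using measurable_component_singleton[OF that, of "\<lambda>_. lborel :: real measure"] by simp
  have "(\<lambda>y. \<lambda>k\<in>{1..K}. if k < K then y k else 1 - (\<Sum>j=1..<K. y j))
          \<in> ?L \<rightarrow>\<^sub>M (\<Pi>\<^sub>M k\<in>{1..K}. borel)"
  proof (rule measurable_restrict)
    fix k assume k: "k \<in> {1..K}"
    show "(\<lambda>y. if k < K then y k else 1 - (\<Sum>j=1..<K. y j)) \<in> borel_measurable ?L"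
      using k by (cases "k < K") (auto intro!: c borel_measurable_diff borel_measurable_sum)
  qed
  then show "param K \<in> restrict_space ?L (param_domain K) \<rightarrow>\<^sub>M (\<Pi>\<^sub>M k\<in>{1..K}. borel)"
    unfolding param_def by (rule measurable_restrict_space1)
qed

lemma param_domain_sets: "param_domain K \<in> sets (\<Pi>\<^sub>M k\<in>{1..<K}. (lborel :: real measure))"
proof -
  let ?L = "\<Pi>\<^sub>M k\<in>{1..<K}. (lborel :: real measure)"
  have c[measurable]: "(\<lambda>y. y j) \<in> borel_measurable ?L" if "j \<in> {1..<K}" for j
    using measurable_component_singleton[OF that, of "\<lambda>_. lborel :: real measure"] by simp
  have "param_domain K = {y \<in> space ?L. (\<forall>k\<in>{1..<K}. 0 \<le> y k) \<and> (\<Sum>k=1..<K. y k) \<le> 1}"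
    by (auto simp: param_domain_def space_PiM)
  also have "\<dots> \<in> sets ?L"
    by (intro sets.sets_Collect_conj sets.sets_Collect_finite_All borel_measurable_le
        borel_measurable_sum borel_measurable_const c) auto
  finally show ?thesis .
qed

lemma prob_space_uniform_market:
  assumes "K \<ge> 1"
  shows "prob_space (uniform_market K)"
proof -
  let ?L = "\<Pi>\<^sub>M k\<in>{1..<K}. (lborel :: real measure)"
  let ?D = "param_domain K"
  have D: "?D = {y. (\<forall>i\<in>{1..<K}. 0 \<le> y i) \<and> sum y {1..<K} \<le> 1} \<inter> space ?L"
    by (auto simp: param_domain_def space_PiM)
  have "emeasure ?L ?D = ennreal (1 / fact (card {1..<K}))"
    unfolding D using emeasure_std_simplex_aux[of "{1..<K}" 1] by simp
  moreover have "emeasure (restrict_space ?L ?D) ?D = emeasure ?L ?D"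
    using param_domain_sets[of K] by (intro emeasure_restrict_space) (auto simp: space_PiM)
  ultimately have em: "emeasure (restrict_space ?L ?D) ?D = ennreal (1 / fact (card {1..<K}))"
    by simp
  have "prob_space (uniform_measure (restrict_space ?L ?D) ?D)"
    by (rule prob_space_uniform_measure) (simp_all only: em, auto)
  moreover have "param K \<in> uniform_measure (restrict_space ?L ?D) ?D \<rightarrow>\<^sub>M market_space K"
    using param_measurable[OF assms] by simp
  ultimately show ?thesis
    unfolding uniform_market_def by (rule prob_space.prob_space_distr)
qed

lemma emeasure_posterior:
  assumes "K \<ge> 1" "\<beta> \<in> {0..1}" "xhat \<in> markets K" "A \<in> sets (market_space K)"
  shows "emeasure (posterior K \<beta> xhat) A =
           ennreal (1 - \<beta>) * indicator A xhat + ennreal \<beta> * emeasure (uniform_market K) A"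
proof -
  let ?f = "\<lambda>b. if b then uniform_market K else return (market_space K) xhat"
  have "?f \<in> measure_pmf (bernoulli_pmf \<beta>) \<rightarrow>\<^sub>M subprob_algebra (market_space K)"
    using assms(3) prob_space_imp_subprob_space[OF prob_space_uniform_market[OF assms(1)]]
      prob_space_imp_subprob_space[OF prob_space_return[of xhat "market_space K"]]
    by (auto simp: space_subprob_algebra uniform_market_def)
  then have "emeasure (posterior K \<beta> xhat) A =
      (\<integral>\<^sup>+b. emeasure (?f b) A \<partial>measure_pmf (bernoulli_pmf \<beta>))"
    unfolding posterior_def using assms(4) by (subst emeasure_bind) auto
  also have "\<dots> = ennreal \<beta> * emeasure (uniform_market K) A
      + ennreal (1 - \<beta>) * emeasure (return (market_space K) xhat) A"
    using assms(2) by (simp add: nn_integral_measure_pmf nn_integral_count_space_finite UNIV_bool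
        add.commute)
  finally show ?thesis using assms(4) by (simp add: add.commute)
qed

lemma mechanism_eq_posterior: "mechanism K \<beta> x = posterior K \<beta> x"
  by (simp add: mechanism_def posterior_def)

end

theory Submission
  imports Defs
begin

text \<open>
  Since utilities are linear in the market, the producer's total utility for \<open>(\<sigma>, \<phi>)\<close> is \<open>1 - \<beta>\<close> times
  his average revenue when each segment is revealed, plus \<open>\<beta>\<close> times the average revenue on the
  aggregated market under prices set for uniformly drawn markets. Finite sets of markets are null for
  the uniform distribution, so the tie-breaking in the two parts can be chosen independently. The second
  part is minimised by a measurable tie-breaking, the first is a linear program over a compact set once
  segments with the same price are merged; so the minimum exists for every \<open>\<beta>\<close>. Without segmentation
  the producer gets at most the uniform-price revenue \<open>max\<^sub>k U\<^sub>p(v\<^sub>k, x\<^sup>*)\<close>, while for \<open>\<beta> = 0\<close>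
  he gets at least that under every segmentation, by charging one fixed price everywhere.
\<close>


subsection \<open>Utilities and the posterior\<close>

text \<open>Revenue at a fixed price is linear in the market. The weights are arbitrary reals, so
  the same fact covers averages over segments, unnormalised mixtures and, with a one-element index
  set, scaling.\<close>

lemma producer_utility_sum:
  "producer_utility K v p (\<lambda>j. \<Sum>i\<in>I. c i * x i j) = (\<Sum>i\<in>I. c i * producer_utility K v p (x i))"
proof -
  have "producer_utility K v p (\<lambda>j. \<Sum>i\<in>I. c i * x i j) =
      (\<Sum>j=1..K. \<Sum>i\<in>I. c i * (p * (x i j * of_bool (p \<le> v j))))"
    unfolding producer_utility_def sum_distrib_left sum_distrib_right
    by (intro sum.cong refl) (simp add: mult_ac)
  also have "\<dots> = (\<Sum>i\<in>I. c i * producer_utility K v p (x i))"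
    unfolding producer_utility_def sum_distrib_left by (rule sum.swap)
  finally show ?thesis .
qed

lemma producer_utility_cong:
  assumes "\<And>j. j \<in> {1..K} \<Longrightarrow> x j = y j"
  shows "producer_utility K v p x = producer_utility K v p y"
  using assms by (simp add: producer_utility_def)

lemma producer_utility_nonneg:
  assumes "x \<in> markets K" "0 \<le> p"
  shows "0 \<le> producer_utility K v p x"
  using assms by (auto simp: producer_utility_def markets_def intro!: mult_nonneg_nonneg sum_nonneg)

lemma producer_utility_le:
  assumes "x \<in> markets K" "0 \<le> p"
  shows "producer_utility K v p x \<le> p"
proof -
  have "(\<Sum>k=1..K. x k * of_bool (p \<le> v k)) \<le> (\<Sum>k=1..K. x k)"
    using assms(1) by (intro sum_mono) (auto simp: markets_def)
  also have "\<dots> = 1" using assms(1) by (simp add: markets_def)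
  finally show ?thesis using assms(2) by (simp add: producer_utility_def mult_left_le)
qed

lemma weight_measurable [measurable]:
  "k \<in> {1..K} \<Longrightarrow> (\<lambda>x. x k) \<in> borel_measurable (market_space K)"
  unfolding market_space_def by (intro measurable_restrict_space1 measurable_component_singleton)

lemma producer_utility_measurable [measurable]:
  "producer_utility K v p \<in> borel_measurable (market_space K)"
  unfolding producer_utility_def[abs_def]
  by (intro borel_measurable_times borel_measurable_sum borel_measurable_const weight_measurable)

lemma singleton_in_sets_market_space:
  assumes "x \<in> markets K"
  shows "{x} \<in> sets (market_space K)"
proof -
  have "{x} = {y \<in> space (market_space K). \<forall>k\<in>{1..K}. y k = x k}"
    using assms PiE_ext[of _ "{1..K}" "\<lambda>_. UNIV" x] unfolding space_market_space markets_def by blast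
  also have "\<dots> \<in> sets (market_space K)"
    by (intro sets.sets_Collect_finite_All borel_measurable_eq borel_measurable_const
        weight_measurable finite_atLeastAtMost)
  finally show ?thesis .
qed

lemma sets_uniform_market [simp, measurable_cong]: "sets (uniform_market K) = sets (market_space K)"
  by (simp add: uniform_market_def)

lemma space_uniform_market [simp]: "space (uniform_market K) = markets K"
  by (simp add: uniform_market_def)

lemma uniform_market_integrable:
  fixes f :: "market \<Rightarrow> real"
  assumes "K \<ge> 1" and "f \<in> borel_measurable (market_space K)"
    and "\<And>x. x \<in> markets K \<Longrightarrow> 0 \<le> f x \<and> f x \<le> B"
  shows "integrable (uniform_market K) f"
proof -
  interpret prob_space "uniform_market K" by (rule prob_space_uniform_market[OF assms(1)])
  show ?thesis
    using assms(2,3) by (intro integrable_const_bound[of _ B] AE_I2) (auto simp: measurable_cong_sets[OF sets_uniform_market refl])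
qed

lemma posterior_kernel:
  assumes "K \<ge> 1" "x \<in> markets K"
  shows "(\<lambda>b. if b then uniform_market K else return (market_space K) x)
    \<in> measure_pmf (bernoulli_pmf \<beta>) \<rightarrow>\<^sub>M subprob_algebra (market_space K)"
  using assms(2) prob_space_imp_subprob_space[OF prob_space_uniform_market[OF assms(1)]]
    prob_space_imp_subprob_space[OF prob_space_return[of x "market_space K"]]
  by (auto simp: space_subprob_algebra)

lemma sets_posterior:
  assumes "K \<ge> 1" "x \<in> markets K"
  shows "sets (posterior K \<beta> x) = sets (market_space K)"
  unfolding posterior_def by (rule sets_bind[OF sets_kernel[OF posterior_kernel[OF assms]]]) auto

lemma space_posterior:
  assumes "K \<ge> 1" "x \<in> markets K"
  shows "space (posterior K \<beta> x) = markets K"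
  using sets_eq_imp_space_eq[OF sets_posterior[OF assms]] by simp

text \<open>The bind is evaluated with nonnegative integrals and converted back to a real integral
  at the end; the upper bound on \<open>f\<close> provides integrability under the uniform
  distribution.\<close>

lemma integral_posterior:
  fixes f :: "market \<Rightarrow> real"
  assumes K: "K \<ge> 1" and b: "\<beta> \<in> {0..1}" and x: "x \<in> markets K"
    and f[measurable]: "f \<in> borel_measurable (market_space K)"
    and bd: "\<And>x. x \<in> markets K \<Longrightarrow> 0 \<le> f x \<and> f x \<le> B"
  shows "(\<integral>y. f y \<partial>posterior K \<beta> x) = (1 - \<beta>) * f x + \<beta> * (\<integral>y. f y \<partial>uniform_market K)"
proof -
  let ?h = "\<lambda>b. if b then uniform_market K else return (market_space K) x"
  have N: "?h \<in> measure_pmf (bernoulli_pmf \<beta>) \<rightarrow>\<^sub>M subprob_algebra (market_space K)"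
    by (rule posterior_kernel[OF K x])
  have S: "sets (posterior K \<beta> x) = sets (market_space K)"
    by (rule sets_posterior[OF K x])
  have sp: "space (posterior K \<beta> x) = markets K"
    by (rule space_posterior[OF K x])
  have "(\<integral>\<^sup>+y. f y \<partial>posterior K \<beta> x) =
      (\<integral>\<^sup>+b. (\<integral>\<^sup>+y. f y \<partial>?h b) \<partial>measure_pmf (bernoulli_pmf \<beta>))"
    unfolding posterior_def by (intro nn_integral_bind[OF _ N]) simp
  also have "\<dots> = ennreal \<beta> * (\<integral>\<^sup>+y. f y \<partial>uniform_market K) + ennreal (1 - \<beta>) * ennreal (f x)"
    using b x by (simp add: nn_integral_measure_pmf nn_integral_count_space_finite UNIV_bool
        add.commute nn_integral_return)
  also have "(\<integral>\<^sup>+y. f y \<partial>uniform_market K) = ennreal (\<integral>y. f y \<partial>uniform_market K)"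
    using bd by (intro nn_integral_eq_integral uniform_market_integrable[OF K f bd]) auto
  also have "ennreal \<beta> * ennreal (\<integral>y. f y \<partial>uniform_market K) + ennreal (1 - \<beta>) * ennreal (f x) =
      ennreal ((1 - \<beta>) * f x + \<beta> * (\<integral>y. f y \<partial>uniform_market K))"
  proof -
    have "0 \<le> (\<integral>y. f y \<partial>uniform_market K)" using bd by (intro integral_nonneg_AE AE_I2) auto
    then show ?thesis using b bd[OF x] by (simp add: ennreal_mult'' add.commute)
  qed
  finally have "(\<integral>\<^sup>+y. f y \<partial>posterior K \<beta> x) =
      ennreal ((1 - \<beta>) * f x + \<beta> * (\<integral>y. f y \<partial>uniform_market K))" .
  moreover have "0 \<le> (1 - \<beta>) * f x + \<beta> * (\<integral>y. f y \<partial>uniform_market K)"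
    using b bd x by (intro add_nonneg_nonneg mult_nonneg_nonneg integral_nonneg_AE) auto
  ultimately show ?thesis
    using bd f by (subst integral_eq_nn_integral)
      (auto simp: sp measurable_cong_sets[OF S refl] enn2real_ennreal)
qed

text \<open>The first \<open>K - 1\<close> weights determine a market, so at most one parameter
  point maps to \<open>x\<close>. A point has Lebesgue measure zero once there is at least one
  coordinate, that is, for \<open>K \<ge> 2\<close>.\<close>

lemma uniform_market_singleton_null:
  assumes "K \<ge> 2" "x \<in> markets K"
  shows "AE y in uniform_market K. y \<noteq> x"
proof -
  let ?L = "\<Pi>\<^sub>M k\<in>{1..<K}. (lborel :: real measure)"
  let ?R = "restrict_space ?L (param_domain K)"
  interpret product_sigma_finite "\<lambda>_. lborel :: real measure" ..
  have "emeasure ?L (\<Pi>\<^sub>E k\<in>{1..<K}. {x k}) = (\<Prod>k\<in>{1..<K}. emeasure lborel {x k})"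
    by (rule emeasure_PiM) auto
  also have "\<dots> = 0" using assms(1) by (intro prod_zero) (auto intro!: bexI[of _ 1])
  finally have "(\<Pi>\<^sub>E k\<in>{1..<K}. {x k}) \<in> null_sets ?L"
    by (auto intro!: null_setsI sets_PiM_I_finite)
  then have "AE y in ?L. y \<notin> (\<Pi>\<^sub>E k\<in>{1..<K}. {x k})"
    by (rule AE_not_in)
  then have "AE y in ?L. y \<in> param_domain K \<longrightarrow> param K y \<noteq> x"
  proof (rule AE_mp, intro AE_I2 impI notI)
    fix y assume y: "y \<notin> (\<Pi>\<^sub>E k\<in>{1..<K}. {x k})" "y \<in> param_domain K" "param K y = x"
    have "y k = x k" if "k \<in> {1..<K}" for k
      using that fun_cong[OF y(3), of k] by (auto simp: param_def)
    with y show False by (auto simp: param_domain_def PiE_def extensional_def)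
  qed
  then have "AE y in ?R. param K y \<noteq> x"
    by (subst AE_restrict_space_iff) (use param_domain_sets[of K] in \<open>auto simp: space_PiM\<close>)
  then have null: "AE y in uniform_measure ?R (param_domain K). param K y \<noteq> x"
    using param_domain_sets[of K]
    by (intro AE_uniform_measureI) (auto simp: sets_restrict_space_iff space_PiM)
  have "{x} \<in> sets (market_space K)"
    by (rule singleton_in_sets_market_space[OF assms(2)])
  then have "space (market_space K) - {x} \<in> sets (market_space K)"
    by (rule sets.compl_sets)
  moreover have "space (market_space K) - {x} = {y \<in> space (market_space K). y \<noteq> x}"
    by blast
  ultimately have meas: "{y \<in> space (market_space K). y \<noteq> x} \<in> sets (market_space K)"
    by argo
  have param: "param K \<in> uniform_measure ?R (param_domain K) \<rightarrow>\<^sub>M market_space K"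
    using param_measurable[of K] assms(1) by simp
  show ?thesis
    unfolding uniform_market_def by (rule iffD2[OF AE_distr_iff[OF param meas] null])
qed

text \<open>Tychonoff's theorem. The index type may be infinite, so plans can be functions on all
  pairs of naturals with the pointwise topology.\<close>

lemma compact_box:
  "compact {z :: 'a \<Rightarrow> real. \<forall>i. z i \<in> {a..b}}"
proof -
  have "compactin (product_topology (\<lambda>_. euclidean) UNIV) (\<Pi>\<^sub>E i\<in>(UNIV :: 'a set). {a..b})"
    by (subst compactin_PiE) auto
  moreover have "(\<Pi>\<^sub>E i\<in>(UNIV :: 'a set). {a..b}) = {z. \<forall>i. z i \<in> {a..b}}"
    by (auto simp: PiE_def Pi_def)
  ultimately show ?thesis
    by (simp add: euclidean_product_topology)
qed

text \<open>The bound on \<open>f\<close> is asked for only where the weight is nonzero, because a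
  pricing rule is constrained only at the prices it charges with positive probability.\<close>

lemma sum_weights_le_imp_le:
  fixes c f :: "'a \<Rightarrow> real"
  assumes "\<And>i. i \<in> I \<Longrightarrow> 0 \<le> c i" "sum c I = 1" "\<And>i. i \<in> I \<Longrightarrow> c i \<noteq> 0 \<Longrightarrow> f i \<le> b"
  shows "(\<Sum>i\<in>I. c i * f i) \<le> b"
proof -
  have "(\<Sum>i\<in>I. c i * f i) \<le> (\<Sum>i\<in>I. c i * b)"
    using assms(1,3) by (intro sum_mono) (metis mult_left_mono mult_zero_left order_refl)
  also have "\<dots> = b" using assms(2) by (simp add: sum_distrib_right[symmetric])
  finally show ?thesis .
qed

lemma sum_weights_ge_imp_ge:
  fixes c f :: "'a \<Rightarrow> real"
  assumes "\<And>i. i \<in> I \<Longrightarrow> 0 \<le> c i" "sum c I = 1" "\<And>i. i \<in> I \<Longrightarrow> c i \<noteq> 0 \<Longrightarrow> b \<le> f i"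
  shows "b \<le> (\<Sum>i\<in>I. c i * f i)"
  using sum_weights_le_imp_le[of I c "\<lambda>i. - f i" "- b"] assms by (simp add: sum_negf)

text \<open>The segments average to the aggregated market, so by linearity a price that does not
  vary across segments cannot profit from the segmentation.\<close>

lemma segmentation_producer_utility:
  assumes "segmentation K xstar \<sigma>"
  shows "(\<Sum>x\<in>set_pmf \<sigma>. pmf \<sigma> x * producer_utility K v p x) = producer_utility K v p xstar"
  using assms unfolding segmentation_def
  by (subst producer_utility_sum[symmetric]) (auto intro: producer_utility_cong)

lemma segmentation_return:
  assumes "xstar \<in> markets K"
  shows "segmentation K xstar (return_pmf xstar)"
  using assms by (simp add: segmentation_def)

subsection \<open>Optimal prices\<close>

text \<open>The parameter is fixed in a locale because the results are needed for two values of it,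
  the given \<open>\<beta>\<close> and 0.\<close>

locale private_pricing =
  fixes K :: nat and v :: "nat \<Rightarrow> real" and \<beta> :: real
  assumes K_ge_2: "K \<ge> 2" and v_first_pos: "0 < v 1" and v_mono: "strict_mono_on {1..K} v"
    and beta: "\<beta> \<in> {0..1}"
begin

abbreviation revenue :: "nat \<Rightarrow> market \<Rightarrow> real" where
  "revenue k \<equiv> producer_utility K v (v k)"

definition prior_revenue :: "nat \<Rightarrow> real" where
  "prior_revenue k = (\<integral>x. revenue k x \<partial>uniform_market K)"

text \<open>
  On markets this is the posterior utility of price \<open>v k\<close>. The total mass multiplying the second
  summand makes it linear in \<open>x\<close>, so that the optimality regions become cones.
\<close>

definition score :: "nat \<Rightarrow> market \<Rightarrow> real" where
  "score k x = (1 - \<beta>) * revenue k x + \<beta> * prior_revenue k * (\<Sum>j=1..K. x j)"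

definition best :: "market \<Rightarrow> nat set" where
  "best x = {k\<in>{1..K}. \<forall>l\<in>{1..K}. score l x \<le> score k x}"

lemma K_ge_1: "K \<ge> 1" using K_ge_2 by simp

lemma v_pos: "k \<in> {1..K} \<Longrightarrow> 0 < v k"
  using strict_mono_onD[OF v_mono, of 1 k] v_first_pos by (cases "k = 1") auto

lemma v_inj: "inj_on v {1..K}"
  by (rule strict_mono_on_imp_inj_on[OF v_mono])

lemma v_le_iff: "i \<in> {1..K} \<Longrightarrow> j \<in> {1..K} \<Longrightarrow> v i \<le> v j \<longleftrightarrow> i \<le> j"
  using strict_mono_on_less_eq[OF v_mono] by blast

lemma revenue_nonneg: "k \<in> {1..K} \<Longrightarrow> x \<in> markets K \<Longrightarrow> 0 \<le> revenue k x"
  using v_pos[of k] by (intro producer_utility_nonneg) auto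

lemma revenue_le: "k \<in> {1..K} \<Longrightarrow> x \<in> markets K \<Longrightarrow> revenue k x \<le> v k"
  using v_pos[of k] by (intro producer_utility_le) auto

lemma score_sum:
  "score k (\<lambda>j. \<Sum>i\<in>I. c i * x i j) = (\<Sum>i\<in>I. c i * score k (x i))"
proof -
  have "(\<Sum>j=1..K. \<Sum>i\<in>I. c i * x i j) = (\<Sum>i\<in>I. c i * (\<Sum>j=1..K. x i j))"
    by (subst sum.swap) (simp add: sum_distrib_left)
  then show ?thesis
    unfolding score_def producer_utility_sum
    by (simp add: sum_distrib_left sum.distrib distrib_left mult_ac)
qed

lemma score_cong: "(\<And>j. j \<in> {1..K} \<Longrightarrow> x j = y j) \<Longrightarrow> score k x = score k y"
  unfolding score_def using producer_utility_cong[of K x y v "v k"] by simp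

lemma score_measurable [measurable]: "score k \<in> borel_measurable (market_space K)"
  unfolding score_def[abs_def]
  by (intro borel_measurable_add borel_measurable_times borel_measurable_sum
      borel_measurable_const producer_utility_measurable weight_measurable)

lemma finite_best: "finite (best x)"
  by (simp add: best_def)

lemma best_subset: "best x \<subseteq> {1..K}"
  by (auto simp: best_def)

lemma best_nonempty: "best x \<noteq> {}"
proof -
  have ne: "{1..K} \<noteq> {}" using K_ge_1 by simp
  have "arg_min_on (\<lambda>k. - score k x) {1..K} \<in> best x"
    using arg_min_if_finite(1)[OF finite_atLeastAtMost ne, of "\<lambda>k. - score k x"]
      arg_min_least[OF finite_atLeastAtMost ne, of _ "\<lambda>k. - score k x"]
    by (simp add: best_def)
  then show ?thesis by blast
qed

lemma posterior_utility_eq: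
  assumes "x \<in> markets K" "0 \<le> p"
  shows "posterior_utility K v \<beta> p x =
    (1 - \<beta>) * producer_utility K v p x + \<beta> * (\<integral>y. producer_utility K v p y \<partial>uniform_market K)"
  unfolding posterior_utility_def
  using assms producer_utility_nonneg producer_utility_le
  by (intro integral_posterior[where B = p] K_ge_1 beta producer_utility_measurable) auto

lemma posterior_utility_score:
  assumes "x \<in> markets K" "k \<in> {1..K}"
  shows "posterior_utility K v \<beta> (v k) x = score k x"
  using assms v_pos[of k]
  by (simp add: posterior_utility_eq score_def prior_revenue_def markets_def)

text \<open>Raising a price to the next valuation keeps the demand.\<close>

lemma price_dominated:
  assumes "0 \<le> p"
  obtains k where "k \<in> {1..K}" "\<And>x. x \<in> markets K \<Longrightarrow> producer_utility K v p x \<le> revenue k x"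
proof (cases "\<exists>k\<in>{1..K}. p \<le> v k")
  case True
  define P where "P k \<longleftrightarrow> k \<in> {1..K} \<and> p \<le> v k" for k
  define k where "k = (LEAST k. P k)"
  have "P k"
    unfolding k_def by (rule LeastI_ex) (use True in \<open>auto simp: P_def\<close>)
  then have k: "k \<in> {1..K}" "p \<le> v k" by (auto simp: P_def)
  have iff: "p \<le> v j \<longleftrightarrow> v k \<le> v j" if j: "j \<in> {1..K}" for j
  proof
    assume "p \<le> v j"
    then have "k \<le> j" unfolding k_def using j by (intro Least_le) (simp add: P_def)
    then show "v k \<le> v j" using v_le_iff[OF k(1) j] by simp
  qed (use k in simp)
  show thesis
  proof (rule that[of k])
    fix x assume x: "x \<in> markets K"
    have "(\<Sum>j=1..K. x j * of_bool (p \<le> v j)) = (\<Sum>j=1..K. x j * of_bool (v k \<le> v j))"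
      using iff by (intro sum.cong) auto
    moreover have "0 \<le> (\<Sum>j=1..K. x j * of_bool (v k \<le> v j))"
      using x by (intro sum_nonneg) (auto simp: markets_def)
    ultimately show "producer_utility K v p x \<le> revenue k x"
      using k by (simp only: producer_utility_def mult_right_mono)
  qed (use k in auto)
next
  case False
  \<comment> \<open>A price above every valuation sells nothing, so any valuation does at least as
    well; the first one is taken.\<close>
  then have "producer_utility K v p x = 0" for x
    unfolding producer_utility_def by simp
  then show thesis
    using that[of 1] K_ge_1 revenue_nonneg[of 1] by auto
qed

text \<open>Any price is dominated by one valuation on all markets at once, hence also in
  expectation under the uniform distribution. Comparing the finitely many scores therefore decides
  optimality among all nonnegative prices.\<close>

lemma optimal_price_iff:
  assumes x: "x \<in> markets K" and k: "k \<in> {1..K}"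
  shows "optimal_price K v \<beta> x (v k) \<longleftrightarrow> k \<in> best x"
proof
  assume opt: "optimal_price K v \<beta> x (v k)"
  have "score l x \<le> score k x" if l: "l \<in> {1..K}" for l
  proof -
    have "posterior_utility K v \<beta> (v l) x \<le> posterior_utility K v \<beta> (v k) x"
      using opt v_pos[OF l] unfolding optimal_price_def by simp
    then show ?thesis using posterior_utility_score[OF x] l k by simp
  qed
  then show "k \<in> best x" using k by (auto simp: best_def)
next
  assume b: "k \<in> best x"
  have "posterior_utility K v \<beta> p x \<le> posterior_utility K v \<beta> (v k) x" if p: "0 \<le> p" for p
  proof -
    obtain l where l: "l \<in> {1..K}"
        "\<And>x. x \<in> markets K \<Longrightarrow> producer_utility K v p x \<le> revenue l x"
      using price_dominated[OF p] by blast
    have int: "integrable (uniform_market K) (producer_utility K v q)" if "0 \<le> q" for q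
      using that producer_utility_nonneg producer_utility_le
      by (intro uniform_market_integrable[where B = q] K_ge_1 producer_utility_measurable) auto
    have "(\<integral>y. producer_utility K v p y \<partial>uniform_market K) \<le> (\<integral>y. revenue l y \<partial>uniform_market K)"
      using l p v_pos[of l] by (intro integral_mono int) auto
    then have "posterior_utility K v \<beta> p x \<le> posterior_utility K v \<beta> (v l) x"
      using beta x p l v_pos[of l]
      by (simp add: posterior_utility_eq add_mono mult_left_mono)
    also have "\<dots> \<le> posterior_utility K v \<beta> (v k) x"
      using b l x k posterior_utility_score[OF x] by (auto simp: best_def)
    finally show ?thesis .
  qed
  then show "optimal_price K v \<beta> x (v k)"
    using v_pos[OF k] by (auto simp: optimal_price_def)
qed

subsection \<open>Splitting the total revenue\<close>

text \<open>\<open>y\<close> is the market that the producer observes and prices for,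
  \<open>x\<close> the one that buys. They coincide when the segment is revealed and are unrelated
  when noise is drawn.\<close>

definition expected_revenue :: "(market \<Rightarrow> real pmf) \<Rightarrow> market \<Rightarrow> market \<Rightarrow> real" where
  "expected_revenue \<phi> y x = (\<Sum>k=1..K. pmf (\<phi> y) (v k) * revenue k x)"

lemma optimal_rule_support:
  assumes "optimal_rule K v \<beta> \<phi>" "x \<in> markets K"
  shows "set_pmf (\<phi> x) \<subseteq> v ` {1..K}"
  using assms by (auto simp: optimal_rule_def)

lemma optimal_rule_best:
  assumes "optimal_rule K v \<beta> \<phi>" "x \<in> markets K" "k \<in> {1..K}" "pmf (\<phi> x) (v k) \<noteq> 0"
  shows "k \<in> best x"
proof -
  have "v k \<in> set_pmf (\<phi> x)" using assms(4) by (simp add: set_pmf_iff)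
  then have "optimal_price K v \<beta> x (v k)"
    using assms(1,2) unfolding optimal_rule_def by blast
  then show ?thesis using optimal_price_iff assms(2,3) by simp
qed

lemma sum_prices: "(\<Sum>q\<in>v ` {1..K}. g q) = (\<Sum>k=1..K. g (v k))"
  using sum.reindex[OF v_inj, of g] by (simp only: o_def)

lemma sum_price_probabilities:
  assumes "optimal_rule K v \<beta> \<phi>" "x \<in> markets K"
  shows "(\<Sum>k=1..K. pmf (\<phi> x) (v k)) = 1"
  unfolding sum_prices[symmetric]
  by (rule sum_pmf_eq_1) (use optimal_rule_support[OF assms] in auto)

lemma expectation_price:
  fixes g :: "real \<Rightarrow> real"
  assumes "optimal_rule K v \<beta> \<phi>" "x \<in> markets K"
  shows "measure_pmf.expectation (\<phi> x) g = (\<Sum>k=1..K. pmf (\<phi> x) (v k) * g (v k))"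
  unfolding sum_prices[symmetric, of "\<lambda>q. pmf (\<phi> x) q * g q"]
  using optimal_rule_support[OF assms]
  by (subst integral_measure_pmf_real[of "v ` {1..K}"]) (auto simp: mult.commute)

lemma expected_revenue_measurable:
  assumes "optimal_rule K v \<beta> \<phi>"
  shows "(\<lambda>y. expected_revenue \<phi> y x) \<in> borel_measurable (market_space K)"
  using assms unfolding expected_revenue_def optimal_rule_def
  by (intro borel_measurable_sum borel_measurable_times borel_measurable_const) auto

lemma expected_revenue_nonneg:
  assumes "x \<in> markets K"
  shows "0 \<le> expected_revenue \<phi> y x"
  unfolding expected_revenue_def
  using revenue_nonneg[OF _ assms] by (intro sum_nonneg mult_nonneg_nonneg) auto

lemma expected_revenue_le:
  assumes "optimal_rule K v \<beta> \<phi>" "y \<in> markets K"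
    and "\<And>k. k \<in> best y \<Longrightarrow> revenue k x \<le> B"
  shows "expected_revenue \<phi> y x \<le> B"
  unfolding expected_revenue_def
  using sum_price_probabilities[OF assms(1,2)] optimal_rule_best[OF assms(1,2)] assms(3)
  by (intro sum_weights_le_imp_le) auto

lemma expected_revenue_ge:
  assumes "optimal_rule K v \<beta> \<phi>" "y \<in> markets K"
    and "\<And>k. k \<in> best y \<Longrightarrow> B \<le> revenue k x"
  shows "B \<le> expected_revenue \<phi> y x"
  unfolding expected_revenue_def
  using sum_price_probabilities[OF assms(1,2)] optimal_rule_best[OF assms(1,2)] assms(3)
  by (intro sum_weights_ge_imp_ge) auto

lemma expected_revenue_bounded:
  assumes "optimal_rule K v \<beta> \<phi>" "y \<in> markets K" "x \<in> markets K"
  shows "0 \<le> expected_revenue \<phi> y x \<and> expected_revenue \<phi> y x \<le> v K"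
proof
  have "revenue k x \<le> v K" if "k \<in> best y" for k
    using that best_subset[of y] revenue_le[OF _ assms(3), of k] v_le_iff[of k K] K_ge_1 by force
  then show "expected_revenue \<phi> y x \<le> v K"
    by (rule expected_revenue_le[OF assms(1,2)])
qed (rule expected_revenue_nonneg[OF assms(3)])

lemma expected_revenue_integrable:
  assumes "optimal_rule K v \<beta> \<phi>" "x \<in> markets K"
  shows "integrable (uniform_market K) (\<lambda>y. expected_revenue \<phi> y x)"
  using expected_revenue_bounded[OF assms(1) _ assms(2)] expected_revenue_measurable[OF assms(1)]
  by (intro uniform_market_integrable[where B = "v K"] K_ge_1)

text \<open>The mechanism is the same measure as the posterior, so the formula for posterior
  integrals applies, with the observed market as the variable of integration.\<close>

lemma rule_utility_producer:
  assumes "optimal_rule K v \<beta> \<phi>" "x \<in> markets K"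
  shows "rule_utility K \<beta> \<phi> (producer_utility K v) x =
    (1 - \<beta>) * expected_revenue \<phi> x x + \<beta> * (\<integral>y. expected_revenue \<phi> y x \<partial>uniform_market K)"
proof -
  have "space (posterior K \<beta> x) = markets K"
    using space_posterior[OF K_ge_1 assms(2)] .
  then have "rule_utility K \<beta> \<phi> (producer_utility K v) x =
      (\<integral>y. expected_revenue \<phi> y x \<partial>posterior K \<beta> x)"
    unfolding rule_utility_def mechanism_eq_posterior expected_revenue_def
    using expectation_price[OF assms(1)] by (intro Bochner_Integration.integral_cong refl) auto
  also have "\<dots> = (1 - \<beta>) * expected_revenue \<phi> x x +
      \<beta> * (\<integral>y. expected_revenue \<phi> y x \<partial>uniform_market K)"
    using assms expected_revenue_bounded expected_revenue_measurable
    by (intro integral_posterior[where B = "v K"] K_ge_1 beta) auto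
  finally show ?thesis .
qed

text \<open>With the observed market \<open>y\<close> held fixed, all segments face the same price
  lottery, so only their average matters.\<close>

lemma segmentation_expected_revenue:
  assumes "segmentation K xstar \<sigma>"
  shows "(\<Sum>x\<in>set_pmf \<sigma>. pmf \<sigma> x * expected_revenue \<phi> y x) = expected_revenue \<phi> y xstar"
proof -
  have "(\<Sum>x\<in>set_pmf \<sigma>. pmf \<sigma> x * expected_revenue \<phi> y x) =
      (\<Sum>k=1..K. pmf (\<phi> y) (v k) * (\<Sum>x\<in>set_pmf \<sigma>. pmf \<sigma> x * revenue k x))"
    unfolding expected_revenue_def sum_distrib_left
    by (subst sum.swap) (simp add: mult_ac)
  then show ?thesis
    by (simp add: segmentation_producer_utility[OF assms] expected_revenue_def)
qed

text \<open>The segmentation enters only the first summand; the noise part depends on the rule and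
  the aggregated market alone.\<close>

definition total_revenue :: "market \<Rightarrow> market pmf \<Rightarrow> (market \<Rightarrow> real pmf) \<Rightarrow> real" where
  "total_revenue xstar \<sigma> \<phi> =
     (1 - \<beta>) * (\<Sum>x\<in>set_pmf \<sigma>. pmf \<sigma> x * expected_revenue \<phi> x x) +
     \<beta> * (\<integral>y. expected_revenue \<phi> y xstar \<partial>uniform_market K)"

lemma total_revenue_eq:
  assumes "segmentation K xstar \<sigma>" "optimal_rule K v \<beta> \<phi>"
  shows "(\<Sum>x\<in>set_pmf \<sigma>. pmf \<sigma> x * rule_utility K \<beta> \<phi> (producer_utility K v) x) =
    total_revenue xstar \<sigma> \<phi>"
proof -
  have sub: "set_pmf \<sigma> \<subseteq> markets K"
    using assms(1) by (simp add: segmentation_def)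
  have "(\<Sum>x\<in>set_pmf \<sigma>. pmf \<sigma> x * (\<integral>y. expected_revenue \<phi> y x \<partial>uniform_market K)) =
      (\<integral>y. (\<Sum>x\<in>set_pmf \<sigma>. pmf \<sigma> x * expected_revenue \<phi> y x) \<partial>uniform_market K)"
    using sub expected_revenue_integrable[OF assms(2)]
    by (subst Bochner_Integration.integral_sum) (auto intro!: integrable_mult_right)
  also have "\<dots> = (\<integral>y. expected_revenue \<phi> y xstar \<partial>uniform_market K)"
    by (simp add: segmentation_expected_revenue[OF assms(1)])
  finally have *: "(\<Sum>x\<in>set_pmf \<sigma>. pmf \<sigma> x * (\<integral>y. expected_revenue \<phi> y x \<partial>uniform_market K)) =
      (\<integral>y. expected_revenue \<phi> y xstar \<partial>uniform_market K)" .
  have "(\<Sum>x\<in>set_pmf \<sigma>. pmf \<sigma> x * rule_utility K \<beta> \<phi> (producer_utility K v) x) =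
      (\<Sum>x\<in>set_pmf \<sigma>. (1 - \<beta>) * (pmf \<sigma> x * expected_revenue \<phi> x x) +
        \<beta> * (pmf \<sigma> x * (\<integral>y. expected_revenue \<phi> y x \<partial>uniform_market K)))"
    using sub by (intro sum.cong refl) (auto simp: rule_utility_producer[OF assms(2)] algebra_simps)
  then show ?thesis
    by (simp add: sum.distrib sum_distrib_left[symmetric] * total_revenue_def)
qed

definition total_revenues :: "market \<Rightarrow> real set" where
  "total_revenues xstar =
     {total_revenue xstar \<sigma> \<phi> | \<sigma> \<phi>. segmentation K xstar \<sigma> \<and> optimal_rule K v \<beta> \<phi>}"

lemma producer_utilities_eq:
  "{u_p. \<exists>u_c. (u_c, u_p) \<in> utility_set K v xstar \<beta>} = total_revenues xstar"
proof -
  have "{u_p. \<exists>u_c. (u_c, u_p) \<in> utility_set K v xstar \<beta>} =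
    {(\<Sum>x\<in>set_pmf \<sigma>. pmf \<sigma> x * rule_utility K \<beta> \<phi> (producer_utility K v) x) | \<sigma> \<phi>.
      segmentation K xstar \<sigma> \<and> optimal_rule K v \<beta> \<phi>}"
    unfolding utility_set_def by blast
  also have "\<dots> = total_revenues xstar"
    unfolding total_revenues_def by (intro Collect_cong) (metis total_revenue_eq)
  finally show ?thesis .
qed

subsection \<open>Adversarial tie-breaking\<close>

text \<open>
  With \<open>F\<close> the support of the segmentation and \<open>t\<close> the aggregated market this minimises both parts
  of the total revenue at once: \<open>F\<close> is finite, hence null for the uniform distribution.
\<close>

definition cheapest :: "market set \<Rightarrow> market \<Rightarrow> market \<Rightarrow> nat" where
  "cheapest F t y = arg_min_on (\<lambda>k. revenue k (if y \<in> F then y else t)) (best y)"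

definition cheapest_rule :: "market set \<Rightarrow> market \<Rightarrow> market \<Rightarrow> real pmf" where
  "cheapest_rule F t y = return_pmf (v (cheapest F t y))"

lemma cheapest_in_best: "cheapest F t y \<in> best y"
  unfolding cheapest_def by (rule arg_min_if_finite(1)[OF finite_best best_nonempty])

lemma cheapest_in_range: "cheapest F t y \<in> {1..K}"
  using cheapest_in_best best_subset by blast

lemma cheapest_le:
  assumes "k \<in> best y"
  shows "revenue (cheapest F t y) (if y \<in> F then y else t) \<le> revenue k (if y \<in> F then y else t)"
  unfolding cheapest_def by (rule arg_min_least[OF finite_best best_nonempty assms])

lemma pmf_cheapest_rule:
  "k \<in> {1..K} \<Longrightarrow> pmf (cheapest_rule F t y) (v k) = of_bool (cheapest F t y = k)"
  unfolding cheapest_rule_def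
  using inj_on_eq_iff[OF v_inj cheapest_in_range[of F t y], of k] by (auto simp: pmf_return)

lemma expected_revenue_cheapest_rule:
  "expected_revenue (cheapest_rule F t) y x = revenue (cheapest F t y) x"
proof -
  have "expected_revenue (cheapest_rule F t) y x =
      (\<Sum>k=1..K. if cheapest F t y = k then revenue k x else 0)"
    unfolding expected_revenue_def by (intro sum.cong refl) (simp add: pmf_cheapest_rule)
  also have "\<dots> = revenue (cheapest F t y) x"
    using cheapest_in_range[of F t y] by (subst sum.delta') auto
  finally show ?thesis .
qed

text \<open>Needed for the measurability of tie-breaking: the set of best prices takes finitely many
  values, and each value is described by finitely many comparisons of measurable scores.\<close>

lemma best_eq_in_sets: "{y \<in> space (market_space K). best y = S} \<in> sets (market_space K)"
proof (cases "S \<subseteq> {1..K}")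
  case True
  then have "{y \<in> space (market_space K). best y = S} = {y \<in> space (market_space K).
      \<forall>k\<in>{1..K}. (\<forall>l\<in>{1..K}. score l y \<le> score k y) = (k \<in> S)}"
    unfolding best_def by blast
  also have "\<dots> \<in> sets (market_space K)"
  proof (rule sets.sets_Collect_finite_All[OF _ finite_atLeastAtMost])
    fix k assume "k \<in> {1..K}"
    have "{y \<in> space (market_space K). \<forall>l\<in>{1..K}. score l y \<le> score k y} \<in> sets (market_space K)"
      by (intro sets.sets_Collect_finite_All borel_measurable_le score_measurable finite_atLeastAtMost)
    then show "{y \<in> space (market_space K). (\<forall>l\<in>{1..K}. score l y \<le> score k y) = (k \<in> S)}
        \<in> sets (market_space K)"
      by (cases "k \<in> S") (simp_all only: simp_thms sets.sets_Collect_neg)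
  qed
  finally show ?thesis .
next
  case False
  then have "{y \<in> space (market_space K). best y = S} = {}" using best_subset by blast
  then show ?thesis by (simp only: sets.empty_sets)
qed

text \<open>Measurability is the only issue. Every subset of the finite set \<open>F\<close> is
  measurable, and off \<open>F\<close> the chosen price depends on the observed market only through
  its set of best prices.\<close>

lemma optimal_cheapest_rule:
  assumes F: "finite F" "F \<subseteq> markets K"
  shows "optimal_rule K v \<beta> (cheapest_rule F t)"
  unfolding optimal_rule_def
proof (intro conjI ballI)
  fix k assume k: "k \<in> {1..K}"
  define A where "A = {x \<in> F. cheapest F t x = k}"
  \<comment> \<open>\<open>A\<close> collects the points of \<open>F\<close> that are charged
    \<open>v k\<close>; \<open>B\<close> collects the markets for which breaking ties against
    \<open>t\<close> selects \<open>k\<close>. Hence \<open>v k\<close> is charged exactly on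
    \<open>A\<close> and on \<open>B\<close> outside \<open>F\<close>.\<close>
  define B where "B = (\<Union>S\<in>{S\<in>Pow {1..K}. arg_min_on (\<lambda>k. revenue k t) S = k}.
    {y \<in> space (market_space K). best y = S})"
  have fin_sets: "G \<in> sets (market_space K)" if "G \<subseteq> F" for G
  proof (rule sets.countable)
    show "countable G" using that F(1) by (intro countable_finite) (rule finite_subset)
    show "{x} \<in> sets (market_space K)" if "x \<in> G" for x
      using that \<open>G \<subseteq> F\<close> F(2) by (intro singleton_in_sets_market_space) blast
  qed
  have A: "A \<in> sets (market_space K)" by (rule fin_sets) (auto simp: A_def)
  have B: "B \<in> sets (market_space K)"
    unfolding B_def by (intro sets.finite_UN best_eq_in_sets) simp
  have "A \<union> (B - F) \<in> sets (market_space K)"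
    by (intro sets.Un sets.Diff A B fin_sets order_refl)
  then have "(\<lambda>y. indicator (A \<union> (B - F)) y :: real) \<in> borel_measurable (market_space K)"
    by (rule borel_measurable_indicator)
  moreover have "pmf (cheapest_rule F t y) (v k) = indicator (A \<union> (B - F)) y"
    if "y \<in> space (market_space K)" for y
    unfolding pmf_cheapest_rule[OF k] using that best_subset[of y]
    by (auto simp: A_def B_def cheapest_def indicator_def)
  ultimately show "(\<lambda>y. pmf (cheapest_rule F t y) (v k)) \<in> borel_measurable (market_space K)"
    by (subst measurable_cong)
next
  fix x assume x: "x \<in> markets K"
  have "optimal_price K v \<beta> x (v (cheapest F t x))"
    using optimal_price_iff[OF x cheapest_in_range] cheapest_in_best by blast
  then show "set_pmf (cheapest_rule F t x) \<subseteq> {p \<in> v ` {1..K}. optimal_price K v \<beta> x p}"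
    using cheapest_in_range by (simp add: cheapest_rule_def)
qed

text \<open>Off the null set \<open>F\<close> the rule charges an optimal price of least revenue on
  \<open>t\<close>, whereas \<open>\<phi>\<close> mixes optimal prices, so the integrands compare
  almost everywhere.\<close>

lemma cheapest_rule_integral_le:
  assumes F: "finite F" "F \<subseteq> markets K" and t: "t \<in> markets K" and opt: "optimal_rule K v \<beta> \<phi>"
  shows "(\<integral>y. expected_revenue (cheapest_rule F t) y t \<partial>uniform_market K) \<le>
    (\<integral>y. expected_revenue \<phi> y t \<partial>uniform_market K)"
proof (rule integral_mono_AE)
  have "AE y in uniform_market K. \<forall>x\<in>F. y \<noteq> x"
    using F uniform_market_singleton_null[OF K_ge_2] by (subst AE_finite_all) auto
  then show "AE y in uniform_market K.
      expected_revenue (cheapest_rule F t) y t \<le> expected_revenue \<phi> y t"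
  proof (rule AE_mp, intro AE_I2 impI)
    fix y assume "y \<in> space (uniform_market K)" and "\<forall>x\<in>F. y \<noteq> x"
    then have "y \<in> markets K" and "y \<notin> F" by auto
    then show "expected_revenue (cheapest_rule F t) y t \<le> expected_revenue \<phi> y t"
      unfolding expected_revenue_cheapest_rule using cheapest_le[of _ y F t]
      by (intro expected_revenue_ge[OF opt]) auto
  qed
qed (intro expected_revenue_integrable opt t optimal_cheapest_rule F)+

lemma cheapest_rule_self_le:
  "x \<in> F \<Longrightarrow> k \<in> best x \<Longrightarrow> expected_revenue (cheapest_rule F t) x x \<le> revenue k x"
  unfolding expected_revenue_cheapest_rule using cheapest_le[of k x F t] by simp

subsection \<open>The linear program\<close>

text \<open>
  In a plan, \<open>z (k, j)\<close> is the mass of consumers with valuation \<open>v j\<close> who are offered the price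
  \<open>v k\<close>; merging all segments with the same price loses nothing, because the markets on which
  \<open>v k\<close> is optimal form a convex set. Entries with indices outside \<open>{1..K}\<close> are irrelevant.
\<close>

definition plans :: "market \<Rightarrow> (nat \<times> nat \<Rightarrow> real) set" where
  "plans xstar = {z. (\<forall>i. z i \<in> {0..1}) \<and> (\<forall>j\<in>{1..K}. (\<Sum>k=1..K. z (k, j)) = xstar j) \<and>
     (\<forall>k\<in>{1..K}. \<forall>l\<in>{1..K}. score l (\<lambda>j. z (k, j)) \<le> score k (\<lambda>j. z (k, j)))}"

text \<open>A row is a market scaled by its mass, so no separate weights appear.\<close>

definition plan_revenue :: "(nat \<times> nat \<Rightarrow> real) \<Rightarrow> real" where
  "plan_revenue z = (\<Sum>k=1..K. revenue k (\<lambda>j. z (k, j)))"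

lemma continuous_on_plan_revenue_row: "continuous_on S (\<lambda>z. revenue l (\<lambda>j. z (k, j)))"
  unfolding producer_utility_def
  by (intro continuous_intros continuous_on_subset[OF continuous_on_product_coordinates]) auto

lemma continuous_on_plan_score_row: "continuous_on S (\<lambda>z. score l (\<lambda>j. z (k, j)))"
  unfolding score_def
  by (intro continuous_intros continuous_on_plan_revenue_row
      continuous_on_subset[OF continuous_on_product_coordinates]) auto

text \<open>A closed subset of a compact box: the remaining constraints are finitely many equations
  and weak inequalities between functions of finitely many coordinates, which are continuous for the
  pointwise topology.\<close>

lemma compact_plans: "compact (plans xstar)"
proof -
  have "plans xstar = {z. \<forall>i. z i \<in> {0..1}} \<inter>
      ((\<Inter>j\<in>{1..K}. {z. (\<Sum>k=1..K. z (k, j)) = xstar j}) \<inter>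
       (\<Inter>k\<in>{1..K}. \<Inter>l\<in>{1..K}. {z. score l (\<lambda>j. z (k, j)) \<le> score k (\<lambda>j. z (k, j))}))"
    unfolding plans_def by blast
  also have "compact \<dots>"
    by (intro compact_Int_closed compact_box closed_Int closed_INT ballI closed_Collect_eq
        closed_Collect_le continuous_on_plan_score_row continuous_on_sum continuous_on_const
        continuous_on_product_coordinates)
  finally show ?thesis .
qed

text \<open>Each segment \<open>x\<close> is split by the price charged, \<open>c k x\<close> being
  its share at price \<open>v k\<close>, and equal prices are merged into a row. A share is nonzero
  only if \<open>k\<close> is best for \<open>x\<close>, and the score inequalities survive
  nonnegative combinations.\<close>

lemma plan_of_rule:
  assumes seg: "segmentation K xstar \<sigma>" and opt: "optimal_rule K v \<beta> \<phi>" and xs: "xstar \<in> markets K"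
  obtains z where "z \<in> plans xstar"
    "plan_revenue z = (\<Sum>x\<in>set_pmf \<sigma>. pmf \<sigma> x * expected_revenue \<phi> x x)"
proof
  define c where "c k x = pmf \<sigma> x * pmf (\<phi> x) (v k)" for k x
  \<comment> \<open>The default 0 keeps the entries outside the index range inside the unit
    box.\<close>
  define z where "z = (\<lambda>(k, j). if k \<in> {1..K} \<and> j \<in> {1..K} then \<Sum>x\<in>set_pmf \<sigma>. c k x * x j else 0)"
  have sub: "set_pmf \<sigma> \<subseteq> markets K" using seg by (simp add: segmentation_def)
  have c_nonneg: "0 \<le> c k x" for k x by (simp add: c_def)
  have z_nonneg: "0 \<le> z i" for i
    using sub c_nonneg
    by (auto simp: z_def markets_def split: prod.split intro!: sum_nonneg mult_nonneg_nonneg)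
  have col: "(\<Sum>k=1..K. z (k, j)) = xstar j" if j: "j \<in> {1..K}" for j
  proof -
    have "(\<Sum>k=1..K. z (k, j)) = (\<Sum>x\<in>set_pmf \<sigma>. \<Sum>k=1..K. c k x * x j)"
      using j by (subst sum.swap) (simp add: z_def)
    also have "\<dots> = (\<Sum>x\<in>set_pmf \<sigma>. pmf \<sigma> x * x j * (\<Sum>k=1..K. pmf (\<phi> x) (v k)))"
      by (simp only: sum_distrib_left) (simp add: c_def mult_ac)
    also have "\<dots> = (\<Sum>x\<in>set_pmf \<sigma>. pmf \<sigma> x * x j)"
      using sub by (intro sum.cong refl) (auto simp: sum_price_probabilities[OF opt, simplified])
    also have "\<dots> = xstar j" using seg j by (simp add: segmentation_def)
    finally show ?thesis .
  qed
  \<comment> \<open>An entry of \<open>z\<close> is at most its column sum, so this places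
    \<open>z\<close> in the unit box.\<close>
  have xs1: "xstar j \<le> 1" if "j \<in> {1..K}" for j
    using xs that member_le_sum[of j "{1..K}" xstar] by (auto simp: markets_def)
  have z_le: "z (k, j) \<le> 1" for k j
  proof (cases "k \<in> {1..K} \<and> j \<in> {1..K}")
    case True
    then have "z (k, j) \<le> (\<Sum>k=1..K. z (k, j))"
      using z_nonneg by (intro member_le_sum) auto
    then show ?thesis using col xs1 True by force
  qed (auto simp: z_def)
  have row_score: "score l (\<lambda>j. z (k, j)) = (\<Sum>x\<in>set_pmf \<sigma>. c k x * score l x)" if "k \<in> {1..K}" for k l
    unfolding score_sum[symmetric] using that by (intro score_cong) (simp add: z_def)
  have row_revenue: "revenue l (\<lambda>j. z (k, j)) = (\<Sum>x\<in>set_pmf \<sigma>. c k x * revenue l x)"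
    if "k \<in> {1..K}" for k l
    unfolding producer_utility_sum[symmetric] using that
    by (intro producer_utility_cong) (simp add: z_def)
  have "score l (\<lambda>j. z (k, j)) \<le> score k (\<lambda>j. z (k, j))" if k: "k \<in> {1..K}" and l: "l \<in> {1..K}" for k l
    unfolding row_score[OF k]
  proof (rule sum_mono)
    fix x assume "x \<in> set_pmf \<sigma>"
    then have "c k x = 0 \<or> k \<in> best x"
      using sub optimal_rule_best[OF opt _ k, of x] by (auto simp: c_def)
    then show "c k x * score l x \<le> c k x * score k x"
      using l c_nonneg[of k x] by (auto simp: best_def intro: mult_left_mono)
  qed
  then show "z \<in> plans xstar"
    using z_nonneg z_le col by (auto simp: plans_def)
  show "plan_revenue z = (\<Sum>x\<in>set_pmf \<sigma>. pmf \<sigma> x * expected_revenue \<phi> x x)"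
    unfolding plan_revenue_def expected_revenue_def sum_distrib_left
    by (subst sum.swap) (simp add: row_revenue c_def mult_ac)
qed

text \<open>Nonzero rows are normalised to markets and drawn with their masses as probabilities. The
  bound is stated for general \<open>f\<close> because the rule it will be applied to depends on the
  support of the segmentation constructed here.\<close>

lemma segmentation_of_plan:
  assumes z: "z \<in> plans xstar" and xs: "xstar \<in> markets K"
  obtains \<sigma> where "segmentation K xstar \<sigma>"
    "\<And>f. (\<And>x k. x \<in> set_pmf \<sigma> \<Longrightarrow> k \<in> best x \<Longrightarrow> f x \<le> revenue k x) \<Longrightarrow>
      (\<Sum>x\<in>set_pmf \<sigma>. pmf \<sigma> x * f x) \<le> plan_revenue z"
proof
  define w where "w k = (if k \<in> {1..K} then \<Sum>j=1..K. z (k, j) else 0)" for k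
  \<comment> \<open>If \<open>w k = 0\<close> the quotient is 0 and \<open>X k\<close> is not a
    market, but then \<open>k\<close> has probability zero under \<open>W\<close>.\<close>
  define X where "X k = (\<lambda>j\<in>{1..K}. z (k, j) / w k)" for k
  define W where "W = embed_pmf w"
  define \<sigma> where "\<sigma> = map_pmf X W"
  have z_nonneg: "0 \<le> z i" for i using z by (cases i) (simp add: plans_def)
  have w_nonneg: "0 \<le> w k" for k using z_nonneg by (auto simp: w_def intro!: sum_nonneg)
  have "(\<Sum>k=1..K. w k) = (\<Sum>k=1..K. \<Sum>j=1..K. z (k, j))"
    by (intro sum.cong) (auto simp: w_def)
  also have "\<dots> = (\<Sum>j=1..K. xstar j)"
    using z by (subst sum.swap) (auto simp: plans_def intro!: sum.cong)
  finally have w_sum: "(\<Sum>k=1..K. w k) = 1" using xs by (simp add: markets_def)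
  have "(\<integral>\<^sup>+k. ennreal (w k) \<partial>count_space UNIV) = (\<Sum>k=1..K. ennreal (w k))"
    by (rule nn_integral_count_space') (auto simp: w_def)
  also have "\<dots> = 1" using w_sum w_nonneg by (subst sum_ennreal) auto
  finally have pmf_W: "pmf W k = w k" for k
    unfolding W_def by (intro pmf_embed_pmf w_nonneg)
  have in_W: "k \<in> set_pmf W \<longleftrightarrow> w k \<noteq> 0" for k by (simp add: set_pmf_iff pmf_W)
  have set_W: "set_pmf W \<subseteq> {1..K}"
    using in_W by (auto simp: w_def split: if_splits)
  then have "finite (set_pmf W)" by (rule finite_subset) simp
  then have fin_\<sigma>: "finite (set_pmf \<sigma>)" by (simp add: \<sigma>_def)
  \<comment> \<open>Different rows may normalise to the same market, so averages over
    \<open>\<sigma>\<close> are pulled back to the row index instead of being reindexed along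
    \<open>X\<close>.\<close>
  have mean: "(\<Sum>x\<in>set_pmf \<sigma>. pmf \<sigma> x * h x) = (\<Sum>k=1..K. w k * h (X k))" for h :: "market \<Rightarrow> real"
  proof -
    have "(\<Sum>x\<in>set_pmf \<sigma>. pmf \<sigma> x * h x) = measure_pmf.expectation \<sigma> h"
      using integral_measure_pmf_real[OF fin_\<sigma>, of \<sigma> h] by (simp add: mult.commute)
    also have "\<dots> = measure_pmf.expectation W (\<lambda>k. h (X k))" by (simp add: \<sigma>_def)
    also have "\<dots> = (\<Sum>k=1..K. w k * h (X k))"
      using set_W by (subst integral_measure_pmf_real[of "{1..K}"]) (auto simp: pmf_W mult.commute)
    finally show ?thesis .
  qed
  have scale: "w k * X k j = z (k, j)" if "k \<in> {1..K}" "j \<in> {1..K}" for k j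
  proof (cases "w k = 0")
    case True
    then have "z (k, j) = 0"
      using that z_nonneg by (simp add: w_def sum_nonneg_eq_0_iff)
    then show ?thesis using True by simp
  qed (use that in \<open>simp add: X_def\<close>)
  \<comment> \<open>Homogeneity is the one-term case of linearity, hence the index set
    \<open>{()}\<close>.\<close>
  have row_score: "w k * score l (X k) = score l (\<lambda>j. z (k, j))" if "k \<in> {1..K}" for k l
    using score_sum[of l "\<lambda>_. w k" "\<lambda>_. X k" "{()}"] score_cong[of "\<lambda>j. w k * X k j" "\<lambda>j. z (k, j)" l]
      scale[OF that] by simp
  have row_revenue: "w k * revenue k (X k) = revenue k (\<lambda>j. z (k, j))" if "k \<in> {1..K}" for k
    using producer_utility_sum[of K v "v k" "\<lambda>_. w k" "\<lambda>_. X k" "{()}"]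
      producer_utility_cong[of K "\<lambda>j. w k * X k j" "\<lambda>j. z (k, j)" v "v k"] scale[OF that] by simp
  have X_market: "X k \<in> markets K" and X_best: "k \<in> best (X k)"
    if k: "k \<in> {1..K}" and nz: "w k \<noteq> 0" for k
  proof -
    have pos: "0 < w k" using w_nonneg[of k] nz by simp
    have "(\<Sum>j=1..K. X k j) = (\<Sum>j=1..K. z (k, j)) / w k"
      unfolding sum_divide_distrib by (intro sum.cong) (auto simp: X_def)
    also have "\<dots> = 1" using k nz by (simp add: w_def)
    finally show "X k \<in> markets K"
      using z_nonneg pos by (auto simp: markets_def X_def)
    have "w k * score l (X k) \<le> w k * score k (X k)" if "l \<in> {1..K}" for l
      using z k that by (simp add: row_score plans_def)
    then show "k \<in> best (X k)"
      using k pos by (auto simp: best_def mult_le_cancel_left_pos)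
  qed
  show "segmentation K xstar \<sigma>"
    unfolding segmentation_def
  proof (intro conjI ballI)
    show "set_pmf \<sigma> \<subseteq> markets K"
      using X_market set_W in_W by (auto simp: \<sigma>_def)
    fix j assume j: "j \<in> {1..K}"
    have "(\<Sum>x\<in>set_pmf \<sigma>. pmf \<sigma> x * x j) = (\<Sum>k=1..K. z (k, j))"
      unfolding mean using scale j by (intro sum.cong) auto
    also have "\<dots> = xstar j" using z j by (simp add: plans_def)
    finally show "(\<Sum>x\<in>set_pmf \<sigma>. pmf \<sigma> x * x j) = xstar j" .
  qed (rule fin_\<sigma>)
  show "(\<Sum>x\<in>set_pmf \<sigma>. pmf \<sigma> x * f x) \<le> plan_revenue z"
    if f: "\<And>x k. x \<in> set_pmf \<sigma> \<Longrightarrow> k \<in> best x \<Longrightarrow> f x \<le> revenue k x" for f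
    unfolding mean plan_revenue_def
  proof (rule sum_mono)
    fix k assume k: "k \<in> {1..K}"
    have "w k * f (X k) \<le> w k * revenue k (X k)"
    proof (cases "w k = 0")
      case False
      then have "X k \<in> set_pmf \<sigma>" using in_W[of k] by (simp add: \<sigma>_def)
      then show ?thesis using f X_best[OF k False] w_nonneg by (intro mult_left_mono) auto
    qed simp
    then show "w k * f (X k) \<le> revenue k (\<lambda>j. z (k, j))" by (simp add: row_revenue[OF k])
  qed
qed

section \<open>Existence of the minimum\<close>

lemma total_revenues_has_minimum:
  assumes xs: "xstar \<in> markets K"
  obtains m where "is_minimum (total_revenues xstar) m"
proof -
  \<comment> \<open>Leaving the aggregated market unsegmented, with any optimal rule, already yields
    a plan.\<close>
  have "\<exists>z. z \<in> plans xstar"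
    using plan_of_rule[OF segmentation_return[OF xs] optimal_cheapest_rule[of "{}" xstar] xs] by auto
  then have "plans xstar \<noteq> {}" by blast
  moreover have "continuous_on (plans xstar) plan_revenue"
    unfolding plan_revenue_def by (intro continuous_intros continuous_on_plan_revenue_row)
  ultimately obtain z where z: "z \<in> plans xstar"
      and min: "\<And>y. y \<in> plans xstar \<Longrightarrow> plan_revenue z \<le> plan_revenue y"
    using continuous_attains_inf[OF compact_plans] by blast
  obtain \<sigma> where seg: "segmentation K xstar \<sigma>"
    and le: "\<And>f. (\<And>x k. x \<in> set_pmf \<sigma> \<Longrightarrow> k \<in> best x \<Longrightarrow> f x \<le> revenue k x) \<Longrightarrow>
      (\<Sum>x\<in>set_pmf \<sigma>. pmf \<sigma> x * f x) \<le> plan_revenue z"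
    using segmentation_of_plan[OF z xs] by blast
  \<comment> \<open>On the support of \<open>\<sigma>\<close> this rule earns at most the minimal
    plan revenue; elsewhere, that is almost everywhere, it breaks ties against the aggregated
    market. So both summands are minimal together.\<close>
  define \<phi> where "\<phi> = cheapest_rule (set_pmf \<sigma>) xstar"
  have F: "finite (set_pmf \<sigma>)" "set_pmf \<sigma> \<subseteq> markets K"
    using seg by (auto simp: segmentation_def)
  have opt: "optimal_rule K v \<beta> \<phi>"
    unfolding \<phi>_def by (rule optimal_cheapest_rule[OF F])
  have first: "(\<Sum>x\<in>set_pmf \<sigma>. pmf \<sigma> x * expected_revenue \<phi> x x) \<le> plan_revenue z"
    unfolding \<phi>_def by (intro le cheapest_rule_self_le)
  have "total_revenue xstar \<sigma> \<phi> \<le> total_revenue xstar \<sigma>' \<phi>'"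
    if seg': "segmentation K xstar \<sigma>'" and opt': "optimal_rule K v \<beta> \<phi>'" for \<sigma>' \<phi>'
  proof -
    obtain y where "y \<in> plans xstar"
        "plan_revenue y = (\<Sum>x\<in>set_pmf \<sigma>'. pmf \<sigma>' x * expected_revenue \<phi>' x x)"
      using plan_of_rule[OF seg' opt' xs] by blast
    then have "(\<Sum>x\<in>set_pmf \<sigma>. pmf \<sigma> x * expected_revenue \<phi> x x) \<le>
        (\<Sum>x\<in>set_pmf \<sigma>'. pmf \<sigma>' x * expected_revenue \<phi>' x x)"
      using first min by force
    moreover have "(\<integral>y. expected_revenue \<phi> y xstar \<partial>uniform_market K) \<le>
        (\<integral>y. expected_revenue \<phi>' y xstar \<partial>uniform_market K)"
      unfolding \<phi>_def by (rule cheapest_rule_integral_le[OF F xs opt'])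
    ultimately show ?thesis
      unfolding total_revenue_def using beta by (intro add_mono mult_left_mono) auto
  qed
  then have "is_minimum (total_revenues xstar) (total_revenue xstar \<sigma> \<phi>)"
    using seg opt by (auto simp: is_minimum_def total_revenues_def)
  then show thesis by (rule that)
qed

section \<open>Comparison with the best uniform price\<close>

lemma no_segmentation_total_revenue:
  assumes xs: "xstar \<in> markets K"
  obtains u k where "u \<in> total_revenues xstar" "k \<in> {1..K}" "u \<le> revenue k xstar"
proof -
  have ne: "{1..K} \<noteq> {}" using K_ge_1 by simp
  define k where "k = arg_min_on (\<lambda>k. - revenue k xstar) {1..K}"
  \<comment> \<open>The premise on \<open>l\<close> is attached to both facts, so the first one is
    later instantiated with \<open>l = 1\<close>.\<close>
  have k: "k \<in> {1..K}" and max: "revenue l xstar \<le> revenue k xstar" if "l \<in> {1..K}" for l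
    using arg_min_if_finite(1)[OF finite_atLeastAtMost ne, of "\<lambda>k. - revenue k xstar"]
      arg_min_least[OF finite_atLeastAtMost ne that, of "\<lambda>k. - revenue k xstar"]
    unfolding k_def by simp_all
  define \<phi> where "\<phi> = cheapest_rule {} xstar"
  have opt: "optimal_rule K v \<beta> \<phi>" unfolding \<phi>_def by (rule optimal_cheapest_rule) auto
  have le: "expected_revenue \<phi> y xstar \<le> revenue k xstar" for y
    unfolding \<phi>_def expected_revenue_cheapest_rule by (rule max[OF cheapest_in_range])
  interpret prob_space "uniform_market K" by (rule prob_space_uniform_market[OF K_ge_1])
  have "(\<integral>y. expected_revenue \<phi> y xstar \<partial>uniform_market K) \<le> revenue k xstar"
    using le by (intro integral_le_const expected_revenue_integrable opt xs AE_I2)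
  then have "(1 - \<beta>) * expected_revenue \<phi> xstar xstar +
      \<beta> * (\<integral>y. expected_revenue \<phi> y xstar \<partial>uniform_market K) \<le> revenue k xstar"
    using beta le[of xstar] by (intro convex_bound_le) auto
  then have "total_revenue xstar (return_pmf xstar) \<phi> \<le> revenue k xstar"
    by (simp add: total_revenue_def)
  then show thesis
    using that[of "total_revenue xstar (return_pmf xstar) \<phi>" k] opt segmentation_return[OF xs]
      k[of 1] K_ge_1 by (auto simp: total_revenues_def)
qed

text \<open>For \<open>\<beta> = 0\<close> the score is the revenue itself, so every segment is
  charged prices that earn at least as much there as \<open>v k\<close>; averaging over segments
  gives the revenue of \<open>v k\<close> on the aggregated market.\<close>

lemma nonprivate_total_revenue_ge:
  assumes "\<beta> = 0" "u \<in> total_revenues xstar" "k \<in> {1..K}"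
  shows "revenue k xstar \<le> u"
proof -
  obtain \<sigma> \<phi> where seg: "segmentation K xstar \<sigma>" and opt: "optimal_rule K v \<beta> \<phi>"
    and u: "u = (\<Sum>x\<in>set_pmf \<sigma>. pmf \<sigma> x * expected_revenue \<phi> x x)"
    using assms(1,2) unfolding total_revenues_def total_revenue_def by auto
  have "revenue k x \<le> revenue l x" if l: "l \<in> best x" for x l
  proof -
    have "score k x \<le> score l x" using l assms(3) by (simp add: best_def)
    then show ?thesis unfolding score_def by (simp add: assms(1))
  qed
  then have "revenue k x \<le> expected_revenue \<phi> x x" if "x \<in> set_pmf \<sigma>" for x
    using that seg by (intro expected_revenue_ge[OF opt]) (auto simp: segmentation_def)
  then have "(\<Sum>x\<in>set_pmf \<sigma>. pmf \<sigma> x * revenue k x) \<le> u"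
    unfolding u by (intro sum_mono mult_left_mono) auto
  then show ?thesis by (simp add: segmentation_producer_utility[OF seg])
qed

end

theorem corollary3:
  fixes K :: nat and v :: "nat \<Rightarrow> real" and xstar :: market and \<beta> :: real
  assumes "K \<ge> 2" and "0 < v 1" and "strict_mono_on {1..K} v"
    and "xstar \<in> markets K" and "\<beta> \<in> {0..1}"
  shows "\<exists>m m0. is_minimum {u_p. \<exists>u_c. (u_c, u_p) \<in> utility_set K v xstar \<beta>} m
           \<and> is_minimum {u_p. \<exists>u_c. (u_c, u_p) \<in> utility_set K v xstar 0} m0
           \<and> m \<le> m0"
proof -
  interpret noisy: private_pricing K v \<beta>
    using assms by unfold_locales
  interpret exact: private_pricing K v 0
    using assms by unfold_locales auto
  obtain m where m: "is_minimum (noisy.total_revenues xstar) m"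
    using noisy.total_revenues_has_minimum[OF assms(4)] .
  obtain m0 where m0: "is_minimum (exact.total_revenues xstar) m0"
    using exact.total_revenues_has_minimum[OF assms(4)] .
  obtain u k where "u \<in> noisy.total_revenues xstar" "k \<in> {1..K}"
      "u \<le> producer_utility K v (v k) xstar"
    using noisy.no_segmentation_total_revenue[OF assms(4)] .
  \<comment> \<open>The chain is \<open>m \<le> u\<close>, then \<open>u\<close> is at most the
    revenue of \<open>v k\<close> on \<open>xstar\<close>, and this is at most \<open>m0\<close>,
    which is itself attained without noise.\<close>
  then have "m \<le> m0"
    using m m0 exact.nonprivate_total_revenue_ge[OF refl, of m0 xstar k]
    unfolding is_minimum_def by fastforce
  then show ?thesis
    unfolding noisy.producer_utilities_eq exact.producer_utilities_eq using m m0 by blast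
qed

end
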